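(* Let $I\subseteq\mathbb{R}$ be an interval, let $G:I\to(0,1)$ be a continuous strictly increasing bijection, and let $X,X_1,X_2,\ldots$ be i.i.d. with law $P$, $P(I)=1$. Let $p_G=\mathbb{E}[G(X)]$ and $b_G=G^{-1}(p_G)$. Assume that $G$ is continuously differentiable on a neighbourhood of $b_G$ and that $G'(b_G)>0$. Put $v_G=\operatorname{Var}(G(X))$, $\tau_G^2=v_G/[G'(b_G)]^2$, and, with $U_i=G(X_i)$ and $n\ge 2$, $$\overline U_n=\frac1n\sum_{i=1}^nU_i,\quad \widehat b_G=G^{-1}(\overline U_n),\quad \widehat v_G=\frac1{n-1}\sum_{i=1}^n(U_i-\overline U_n)^2,\quad \widehat\tau_G^2=\frac{\widehat v_G}{[G'(\widehat b_G)]^2}.$$ Then $\widehat\tau_G^2\to\tau_G^2$ in probability as $n\to\infty$. Thus $\widehat\tau_G^2/n$ consistently estimates $\tau_G^2/n$, the first-order sampling variance of $\widehat b_G$, in the sense that $n(\widehat\tau_G^2/n-\tau_G^2/n)\to0$ in probability.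
   Context: $G$ is called a probability coordinate chart, $p_G$ the coordinate mean, and $b_G$ the probability barycenter. The estimators depend on $n$. If $G$ is not differentiable at $\widehat b_G$ or $G'(\widehat b_G)=0$, the value of $\widehat\tau_G^2$ is set by convention to $0$. *)

theory Defs
  imports "HOL-Probability.Probability"
begin

definition probability_chart :: "real set \<Rightarrow> (real \<Rightarrow> real) \<Rightarrow> bool" where
  "probability_chart I G \<longleftrightarrow>
     is_interval I \<and> continuous_on I G \<and> strict_mono_on I G \<and> bij_betw G I {0<..<1}"

text \<open>A chart is a total function of which only the values on \<open>I\<close> matter.  Where \<open>G\<close> is composed
  with a random variable lying in \<open>I\<close> only almost surely, the null event on which it leaves \<open>I\<close> gets
  the value 0; otherwise arbitrary values of \<open>G\<close> outside \<open>I\<close> could destroy measurability.\<close>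

definition chart_value :: "real set \<Rightarrow> (real \<Rightarrow> real) \<Rightarrow> real \<Rightarrow> real" where
  "chart_value I G x = (if x \<in> I then G x else 0)"

definition coord_mean :: "'a measure \<Rightarrow> real set \<Rightarrow> (real \<Rightarrow> real) \<Rightarrow> ('a \<Rightarrow> real) \<Rightarrow> real" where
  "coord_mean M I G X = prob_space.expectation M (\<lambda>\<omega>. chart_value I G (X \<omega>))"

definition coord_var :: "'a measure \<Rightarrow> real set \<Rightarrow> (real \<Rightarrow> real) \<Rightarrow> ('a \<Rightarrow> real) \<Rightarrow> real" where
  "coord_var M I G X = prob_space.variance M (\<lambda>\<omega>. chart_value I G (X \<omega>))"

definition barycenter :: "'a measure \<Rightarrow> real set \<Rightarrow> (real \<Rightarrow> real) \<Rightarrow> ('a \<Rightarrow> real) \<Rightarrow> real" where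
  "barycenter M I G X = inv_into I G (coord_mean M I G X)"

definition tau_sq :: "'a measure \<Rightarrow> real set \<Rightarrow> (real \<Rightarrow> real) \<Rightarrow> ('a \<Rightarrow> real) \<Rightarrow> real" where
  "tau_sq M I G X = coord_var M I G X / (deriv G (barycenter M I G X))\<^sup>2"

text \<open>In the estimators, \<open>X 1, \<dots>, X n\<close> is the sample; \<open>X 0\<close> is not used.\<close>

definition sample_mean ::
  "real set \<Rightarrow> (real \<Rightarrow> real) \<Rightarrow> (nat \<Rightarrow> 'a \<Rightarrow> real) \<Rightarrow> nat \<Rightarrow> 'a \<Rightarrow> real" where
  "sample_mean I G X n \<omega> = (\<Sum>i=1..n. chart_value I G (X i \<omega>)) / real n"

definition barycenter_est ::
  "real set \<Rightarrow> (real \<Rightarrow> real) \<Rightarrow> (nat \<Rightarrow> 'a \<Rightarrow> real) \<Rightarrow> nat \<Rightarrow> 'a \<Rightarrow> real" where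
  "barycenter_est I G X n \<omega> = inv_into I G (sample_mean I G X n \<omega>)"

definition var_est ::
  "real set \<Rightarrow> (real \<Rightarrow> real) \<Rightarrow> (nat \<Rightarrow> 'a \<Rightarrow> real) \<Rightarrow> nat \<Rightarrow> 'a \<Rightarrow> real" where
  "var_est I G X n \<omega> =
     (\<Sum>i=1..n. (chart_value I G (X i \<omega>) - sample_mean I G X n \<omega>)\<^sup>2) / (real n - 1)"

text \<open>Every interval \<open>I\<close> carrying a chart is open, so differentiability of the total function \<open>G\<close> at
  a point of \<open>I\<close> depends only on \<open>G\<close> restricted to \<open>I\<close>.\<close>

definition tau_sq_est ::
  "real set \<Rightarrow> (real \<Rightarrow> real) \<Rightarrow> (nat \<Rightarrow> 'a \<Rightarrow> real) \<Rightarrow> nat \<Rightarrow> 'a \<Rightarrow> real" where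
  "tau_sq_est I G X n \<omega> =
     (let b = barycenter_est I G X n \<omega> in
      if G differentiable (at b) \<and> deriv G b \<noteq> 0
      then var_est I G X n \<omega> / (deriv G b)\<^sup>2 else 0)"

text \<open>Measurability is part of the definition because \<^const>\<open>measure\<close> is 0 on non-measurable sets.\<close>

definition converges_in_probability ::
  "'a measure \<Rightarrow> (nat \<Rightarrow> 'a \<Rightarrow> real) \<Rightarrow> ('a \<Rightarrow> real) \<Rightarrow> bool" where
  "converges_in_probability M Y Z \<longleftrightarrow>
     (\<forall>n. Y n \<in> borel_measurable M) \<and> Z \<in> borel_measurable M \<and>
     (\<forall>\<epsilon>>0. (\<lambda>n. measure M {\<omega> \<in> space M. \<bar>Y n \<omega> - Z \<omega>\<bar> > \<epsilon>}) \<longlonglongrightarrow> 0)"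

end

theory Submission
  imports Defs "HOL-Real_Asymp.Real_Asymp"
begin

text \<open>By Hoeffding's inequality the sample means of \<open>G(X\<^sub>i)\<close> and \<open>G(X\<^sub>i)\<^sup>2\<close> converge in
  probability, and the estimator is a function of these two means and of \<open>n\<close> that converges jointly
  at the limit point, since \<open>G' \<circ> G\<^sup>-\<^sup>1\<close> is continuous and nonzero there.  The remaining issue is
  Borel measurability of the estimator far from \<open>b\<^sub>G\<close>, where \<open>G\<close> is merely continuous: whether
  a continuous function is differentiable at a point is a countable condition on its rational
  difference quotients.\<close>

section \<open>Convergence in probability\<close>

text \<open>Boundedness lets Hoeffding's inequality apply, and its tail bound decays exponentially
  in \<open>n\<close>. \<open>Y 0\<close> serves only as a representative of the common law; the
  averages start at index 1.\<close>

lemma (in prob_space) weak_law_bounded_iid: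
  fixes Y :: "nat \<Rightarrow> 'a \<Rightarrow> real" and a b :: real
  assumes indep: "indep_vars (\<lambda>_. borel) Y UNIV"
    and distr: "\<And>i. distr M borel (Y i) = distr M borel (Y 0)"
    and bounded: "AE \<omega> in M. Y 0 \<omega> \<in> {a..b}" and "a < b"
  shows "converges_in_probability M (\<lambda>n \<omega>. (\<Sum>i=1..n. Y i \<omega>) / real n) (\<lambda>_. expectation (Y 0))"
proof -
  have [measurable]: "random_variable borel (Y i)" for i
    using indep unfolding indep_vars_def by blast
  have "(\<lambda>n. prob {\<omega> \<in> space M. \<bar>(\<Sum>i=1..n. Y i \<omega>) / real n - expectation (Y 0)\<bar> > \<epsilon>}) \<longlonglongrightarrow> 0"
    if "\<epsilon> > 0" for \<epsilon>
  proof (rule tendsto_sandwich[of "\<lambda>_. 0"])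
    have "prob {\<omega> \<in> space M. \<bar>(\<Sum>i=1..n. Y i \<omega>) / real n - expectation (Y 0)\<bar> > \<epsilon>}
        \<le> 2 * exp (-2 * real n * \<epsilon>\<^sup>2 / (b - a)\<^sup>2)" if "n \<ge> 1" for n
    proof -
      interpret Hoeffding_ineq_iid M "{1..n}" Y "Y 0" a b "expectation (Y 0)"
      proof unfold_locales
        show "indep_vars (\<lambda>_. borel) Y {1..n}"
          by (rule indep_vars_subset[OF indep]) simp
        show "distr M borel (Y i) = distr M borel (Y 0)" for i
          by (rule distr)
        show "AE \<omega> in M. Y 0 \<omega> \<in> {a..b}"
          by (rule bounded)
      qed auto
      have "prob {\<omega> \<in> space M. \<bar>(\<Sum>i=1..n. Y i \<omega>) / real n - expectation (Y 0)\<bar> > \<epsilon>}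
          \<le> prob {\<omega> \<in> space M. \<bar>(\<Sum>i=1..n. Y i \<omega>) / real n - expectation (Y 0)\<bar> \<ge> \<epsilon>}"
        by (rule finite_measure_mono) auto
      also have "\<dots> \<le> 2 * exp (-2 * real n * \<epsilon>\<^sup>2 / (b - a)\<^sup>2)"
        using Hoeffding_ineq_abs_ge'[of \<epsilon>] \<open>\<epsilon> > 0\<close> \<open>a < b\<close> \<open>n \<ge> 1\<close> by simp
      finally show ?thesis .
    qed
    then show "\<forall>\<^sub>F n in sequentially.
        prob {\<omega> \<in> space M. \<bar>(\<Sum>i=1..n. Y i \<omega>) / real n - expectation (Y 0)\<bar> > \<epsilon>}
        \<le> 2 * exp (-2 * real n * \<epsilon>\<^sup>2 / (b - a)\<^sup>2)"
      by (rule eventually_sequentiallyI)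
    \<comment> \<open>The exponent is gathered into one positive rate so that the limit becomes a
      plain exponential decay in \<open>n\<close>.\<close>
    define c where "c = 2 * \<epsilon>\<^sup>2 / (b - a)\<^sup>2"
    have "c > 0"
      using \<open>\<epsilon> > 0\<close> \<open>a < b\<close> by (simp add: c_def)
    then have "(\<lambda>n. 2 * exp (- c * real n)) \<longlonglongrightarrow> 0"
      by real_asymp
    then show "(\<lambda>n. 2 * exp (-2 * real n * \<epsilon>\<^sup>2 / (b - a)\<^sup>2)) \<longlonglongrightarrow> 0"
      by (simp add: c_def mult_ac)
  qed auto
  then show ?thesis
    by (auto simp: converges_in_probability_def)
qed

text \<open>A continuous mapping theorem in which \<open>F\<close> may also vary with
  \<open>n\<close>, which later absorbs the factor n/(n-1). The filter limit controls
  \<open>F\<close> only for large \<open>n\<close> and near \<open>(a, b)\<close>, so measurability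
  of the composition is a separate hypothesis.\<close>

lemma (in prob_space) converges_in_probability_compose2:
  fixes F :: "nat \<Rightarrow> real \<Rightarrow> real \<Rightarrow> real"
  assumes A: "converges_in_probability M A (\<lambda>_. a)"
    and B: "converges_in_probability M B (\<lambda>_. b)"
    and meas: "\<And>n. (\<lambda>\<omega>. F n (A n \<omega>) (B n \<omega>)) \<in> borel_measurable M"
    and lim: "((\<lambda>(n, x, y). F n x y) \<longlongrightarrow> c) (sequentially \<times>\<^sub>F nhds a \<times>\<^sub>F nhds b)"
  shows "converges_in_probability M (\<lambda>n \<omega>. F n (A n \<omega>) (B n \<omega>)) (\<lambda>_. c)"
proof -
  have [measurable]: "A n \<in> borel_measurable M" "B n \<in> borel_measurable M" for n
    using A B by (auto simp: converges_in_probability_def)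
  have "(\<lambda>n. prob {\<omega> \<in> space M. \<bar>F n (A n \<omega>) (B n \<omega>) - c\<bar> > \<epsilon>}) \<longlonglongrightarrow> 0"
    if "\<epsilon> > 0" for \<epsilon>
  proof -
    have "\<forall>\<^sub>F (n, x, y) in sequentially \<times>\<^sub>F nhds (a, b). \<bar>F n x y - c\<bar> < \<epsilon>"
      using tendstoD[OF lim \<open>\<epsilon> > 0\<close>] by (simp add: nhds_prod dist_real_def case_prod_unfold)
    then obtain N U where "eventually N sequentially" "eventually U (nhds (a, b))"
      and NU: "\<And>n z. N n \<Longrightarrow> U z \<Longrightarrow> \<bar>F n (fst z) (snd z) - c\<bar> < \<epsilon>"
      by (auto simp: eventually_prod_filter case_prod_unfold)
    then obtain V W where "eventually V (nhds a)" "eventually W (nhds b)"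
      and VW: "\<And>x y. V x \<Longrightarrow> W y \<Longrightarrow> U (x, y)"
      by (auto simp: nhds_prod eventually_prod_filter)
    then obtain d e where "d > 0" "e > 0" and d: "\<And>x. dist x a < d \<Longrightarrow> V x"
      and e: "\<And>y. dist y b < e \<Longrightarrow> W y"
      by (auto simp: eventually_nhds_metric)
    \<comment> \<open>The events in the definition of convergence use a strict inequality. Their
      complements only give distance at most \<open>d / 2\<close> or \<open>e / 2\<close>; halving
      the radii makes this strictly less than \<open>d\<close> and \<open>e\<close>.\<close>
    have close: "\<bar>F n x y - c\<bar> < \<epsilon>"
      if "N n" "\<not> \<bar>x - a\<bar> > d / 2" "\<not> \<bar>y - b\<bar> > e / 2" for n x y
    proof -
      have "V x" "W y"
        using that \<open>d > 0\<close> \<open>e > 0\<close> by (auto intro!: d e simp: dist_real_def)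
      then show ?thesis
        using NU[OF \<open>N n\<close> VW] by simp
    qed
    let ?A = "\<lambda>n. {\<omega> \<in> space M. \<bar>A n \<omega> - a\<bar> > d / 2}"
    let ?B = "\<lambda>n. {\<omega> \<in> space M. \<bar>B n \<omega> - b\<bar> > e / 2}"
    show ?thesis
    proof (rule tendsto_sandwich[of "\<lambda>_. 0"])
      have "prob {\<omega> \<in> space M. \<bar>F n (A n \<omega>) (B n \<omega>) - c\<bar> > \<epsilon>} \<le> prob (?A n) + prob (?B n)"
        if "N n" for n
      proof -
        have "{\<omega> \<in> space M. \<bar>F n (A n \<omega>) (B n \<omega>) - c\<bar> > \<epsilon>} \<subseteq> ?A n \<union> ?B n"
          using close[OF that] by (fastforce dest: less_asym)
        then have "prob {\<omega> \<in> space M. \<bar>F n (A n \<omega>) (B n \<omega>) - c\<bar> > \<epsilon>} \<le> prob (?A n \<union> ?B n)"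
          by (rule finite_measure_mono) simp
        also have "\<dots> \<le> prob (?A n) + prob (?B n)"
          by (rule measure_Un_le) auto
        finally show ?thesis .
      qed
      then show "\<forall>\<^sub>F n in sequentially.
          prob {\<omega> \<in> space M. \<bar>F n (A n \<omega>) (B n \<omega>) - c\<bar> > \<epsilon>} \<le> prob (?A n) + prob (?B n)"
        using \<open>eventually N sequentially\<close> by (auto elim: eventually_mono)
      have "(\<lambda>n. prob (?A n)) \<longlonglongrightarrow> 0" "(\<lambda>n. prob (?B n)) \<longlonglongrightarrow> 0"
        using A B half_gt_zero[OF \<open>d > 0\<close>] half_gt_zero[OF \<open>e > 0\<close>]
        unfolding converges_in_probability_def by blast+
      then show "(\<lambda>n. prob (?A n) + prob (?B n)) \<longlonglongrightarrow> 0"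
        using tendsto_add by fastforce
    qed auto
  qed
  then show ?thesis
    using meas by (auto simp: converges_in_probability_def)
qed

section \<open>Borel measurability of the derivative\<close>

text \<open>The part of \<open>S\<close> where \<open>f\<close> exceeds \<open>c\<close> is open, so
  if it were nonempty it would contain a rational.\<close>

lemma le_of_rational_le:
  fixes f :: "real \<Rightarrow> real"
  assumes "open S" "continuous_on S f" "\<And>r. r \<in> S \<Longrightarrow> r \<in> \<rat> \<Longrightarrow> f r \<le> c" "h \<in> S"
  shows "f h \<le> c"
proof (rule ccontr)
  assume "\<not> f h \<le> c"
  then have "h \<in> S \<inter> f -` {c<..}"
    using \<open>h \<in> S\<close> by simp
  moreover have "open (S \<inter> f -` {c<..})"
    using assms by (intro continuous_open_preimage) auto
  ultimately obtain e where "e > 0" "ball h e \<subseteq> S \<inter> f -` {c<..}"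
    by (meson openE)
  moreover obtain r where "r \<in> \<rat>" "h < r" "r < h + e"
    using Rats_dense_in_real[of h "h + e"] \<open>e > 0\<close> by auto
  ultimately have "r \<in> S \<inter> f -` {c<..}"
    by (auto simp: dist_real_def subset_eq)
  then show False
    using assms(3)[of r] \<open>r \<in> \<rat>\<close> by simp
qed

text \<open>This is the Cauchy criterion for the limit of the difference quotient at 0. Continuity
  of \<open>f\<close> near \<open>x\<close> makes rational increments sufficient, and the non-strict
  bound \<open>1 / Suc m\<close> survives passage to limits.\<close>

lemma differentiable_iff_rational_Cauchy:
  fixes f :: "real \<Rightarrow> real"
  assumes "open U" "continuous_on U f" "x \<in> U"
  defines "q \<equiv> \<lambda>h. (f (x + h) - f x) / h"
  shows "f differentiable (at x) \<longleftrightarrow>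
    (\<forall>m::nat. \<exists>n::nat. \<forall>h\<in>\<rat>. \<forall>k\<in>\<rat>. 0 < \<bar>h\<bar> \<and> \<bar>h\<bar> < 1 / Suc n \<and> 0 < \<bar>k\<bar> \<and> \<bar>k\<bar> < 1 / Suc n
        \<longrightarrow> \<bar>q h - q k\<bar> \<le> 1 / Suc m)" (is "_ \<longleftrightarrow> ?R")
proof
  assume "f differentiable (at x)"
  then obtain L where "(f has_field_derivative L) (at x)"
    by (auto simp: real_differentiable_def)
  then have lim: "(q \<longlongrightarrow> L) (at 0)"
    by (simp add: DERIV_def q_def)
  show ?R
  proof
    fix m :: nat
    define e where "e = 1 / real (Suc m)"
    then have "e / 2 > 0"
      by simp
    then obtain d where "d > 0" and d: "\<And>h. h \<noteq> 0 \<Longrightarrow> \<bar>h\<bar> < d \<Longrightarrow> \<bar>q h - L\<bar> < e / 2"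
      using tendstoD[OF lim \<open>e / 2 > 0\<close>] by (auto simp: eventually_at dist_real_def)
    obtain n :: nat where "1 / Suc n < d"
      using reals_Archimedean[OF \<open>d > 0\<close>] by (auto simp: inverse_eq_divide)
    have "\<bar>q h - q k\<bar> \<le> e"
      if "0 < \<bar>h\<bar> \<and> \<bar>h\<bar> < 1 / Suc n \<and> 0 < \<bar>k\<bar> \<and> \<bar>k\<bar> < 1 / Suc n" for h k
    proof -
      have "\<bar>q h - L\<bar> < e / 2" "\<bar>q k - L\<bar> < e / 2"
        using that \<open>1 / Suc n < d\<close> by (metis d less_trans zero_less_abs_iff)+
      then show ?thesis
        by linarith
    qed
    then show "\<exists>n. \<forall>h\<in>\<rat>. \<forall>k\<in>\<rat>. 0 < \<bar>h\<bar> \<and> \<bar>h\<bar> < 1 / Suc n \<and> 0 < \<bar>k\<bar> \<and> \<bar>k\<bar> < 1 / Suc n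
        \<longrightarrow> \<bar>q h - q k\<bar> \<le> 1 / Suc m"
      unfolding e_def by blast
  qed
next
  assume R: ?R
  \<comment> \<open>One rational sequence of increments tending to 0 produces the candidate
    \<open>L\<close> for the derivative.\<close>
  define s where "s i = q (1 / Suc i)" for i :: nat
  have small: "1 / real (Suc i) < 1 / Suc n" if "i > n" for i n
    using that by (simp add: field_simps)
  have s_Rats: "1 / real (Suc i) \<in> \<rat>" for i
    by (simp del: of_nat_Suc)
  have "Cauchy s"
  proof (rule CauchyI')
    fix e :: real assume "e > 0"
    then obtain m :: nat where "1 / Suc m < e"
      using reals_Archimedean[OF \<open>e > 0\<close>] by (auto simp: inverse_eq_divide)
    obtain n :: nat where n: "\<And>h k. h \<in> \<rat> \<Longrightarrow> k \<in> \<rat> \<Longrightarrow> 0 < \<bar>h\<bar> \<Longrightarrow> \<bar>h\<bar> < 1 / Suc n \<Longrightarrow>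
        0 < \<bar>k\<bar> \<Longrightarrow> \<bar>k\<bar> < 1 / Suc n \<Longrightarrow> \<bar>q h - q k\<bar> \<le> 1 / Suc m"
      using R by meson
    have "dist (s i) (s j) < e" if "i > n" "j > n" for i j
    proof -
      have "\<bar>q (1 / Suc i) - q (1 / Suc j)\<bar> \<le> 1 / Suc m"
        by (rule n) (use s_Rats small that in \<open>auto simp del: of_nat_Suc\<close>)
      with \<open>1 / Suc m < e\<close> show ?thesis
        by (simp add: s_def dist_real_def)
    qed
    then show "\<exists>M. \<forall>m\<ge>M. \<forall>n>m. dist (s m) (s n) < e"
      by (intro exI[of _ "Suc n"]) simp
  qed
  then obtain L where L: "s \<longlonglongrightarrow> L"
    using Cauchy_convergent convergent_def by blast
  have "(q \<longlongrightarrow> L) (at 0)"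
  proof (rule tendstoI)
    fix e :: real assume "e > 0"
    then obtain m where m: "1 / Suc m < e"
      using reals_Archimedean[OF \<open>e > 0\<close>] by (auto simp: inverse_eq_divide)
    obtain n :: nat where n: "\<And>h k. h \<in> \<rat> \<Longrightarrow> k \<in> \<rat> \<Longrightarrow> 0 < \<bar>h\<bar> \<Longrightarrow> \<bar>h\<bar> < 1 / Suc n \<Longrightarrow>
        0 < \<bar>k\<bar> \<Longrightarrow> \<bar>k\<bar> < 1 / Suc n \<Longrightarrow> \<bar>q h - q k\<bar> \<le> 1 / Suc m"
      using R by meson
    obtain d where "d > 0" "ball x d \<subseteq> U"
      using \<open>open U\<close> \<open>x \<in> U\<close> openE by blast
    \<comment> \<open>The second increment runs along \<open>1 / Suc i\<close>, so in the limit
      \<open>q k\<close> is replaced by \<open>L\<close>.\<close>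
    have rational: "\<bar>q h - L\<bar> \<le> 1 / Suc m" if "h \<in> \<rat>" "0 < \<bar>h\<bar>" "\<bar>h\<bar> < 1 / Suc n" for h
    proof (rule tendsto_upperbound)
      show "(\<lambda>i. \<bar>q h - s i\<bar>) \<longlonglongrightarrow> \<bar>q h - L\<bar>"
        by (intro tendsto_intros L)
      show "\<forall>\<^sub>F i in sequentially. \<bar>q h - s i\<bar> \<le> 1 / Suc m"
        using eventually_gt_at_top[of n]
        by (rule eventually_mono)
          (use n[of h] s_Rats small that in \<open>auto simp: s_def simp del: of_nat_Suc\<close>)
    qed simp
    \<comment> \<open>Radius \<open>d\<close> keeps \<open>x + h\<close> inside \<open>U\<close>,
      radius \<open>1 / Suc n\<close> keeps the Cauchy bound valid, and removing 0 makes the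
      quotient continuous in \<open>h\<close>.\<close>
    let ?S = "ball 0 (min d (1 / Suc n)) - {0::real}"
    have "continuous_on ?S (\<lambda>h. \<bar>q h - L\<bar>)"
      unfolding q_def
      by (intro continuous_intros continuous_on_compose2[OF \<open>continuous_on U f\<close>])
        (use \<open>ball x d \<subseteq> U\<close> in \<open>auto simp: subset_eq dist_real_def\<close>)
    then have near: "\<bar>q h - L\<bar> \<le> 1 / Suc m" if "h \<in> ?S" for h
      by (rule le_of_rational_le[where S = ?S, rotated])
        (use that in \<open>auto intro!: rational simp del: of_nat_Suc\<close>)
    show "\<forall>\<^sub>F h in at 0. dist (q h) L < e"
      unfolding eventually_at dist_real_def
    proof (intro exI conjI ballI impI)
      show "min d (1 / Suc n) > 0"
        using \<open>d > 0\<close> by simp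
      show "\<bar>q h - L\<bar> < e" if "h \<noteq> 0 \<and> \<bar>h - 0\<bar> < min d (1 / Suc n)" for h
        using near[of h] m that by (simp add: dist_real_def)
    qed
  qed
  then have "(f has_field_derivative L) (at x)"
    by (simp add: DERIV_def q_def)
  then show "f differentiable (at x)"
    using real_differentiable_def by blast
qed

text \<open>The differentiability set is cut out by countably many conditions on measurable
  difference quotients, and on it the derivative is a pointwise limit of such quotients. Extending
  \<open>f\<close> by 0 outside \<open>U\<close> makes the quotients measurable on the whole line;
  since \<open>U\<close> is open, derivatives at points of \<open>U\<close> are unaffected.\<close>

lemma borel_measurable_deriv_on_open:
  fixes f :: "real \<Rightarrow> real"
  assumes "open U" "continuous_on U f"
  shows "(\<lambda>x. if x \<in> U \<and> f differentiable (at x) then deriv f x else 0) \<in> borel_measurable borel"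
proof -
  define F where "F x = (if x \<in> U then f x else 0)" for x
  have [measurable]: "F \<in> borel_measurable borel" "U \<in> sets borel"
    unfolding F_def using assms by (auto intro!: borel_measurable_continuous_on_if)
  define q where "q h x = (F (x + h) - F x) / h" for h x
  have [measurable]: "q h \<in> borel_measurable borel" for h
    unfolding q_def by measurable
  have same_derivative: "(F has_field_derivative L) (at x) \<longleftrightarrow> (f has_field_derivative L) (at x)"
    if "x \<in> U" for x L
    by (rule DERIV_cong_ev)
      (use \<open>open U\<close> that in \<open>auto simp: F_def eventually_nhds\<close>)
  have contF: "continuous_on U F"
    using \<open>continuous_on U f\<close> by (auto simp: F_def cong: continuous_on_cong)
  define D where "D = {x. x \<in> U \<and> f differentiable (at x)}"
  \<comment> \<open>The criterion is applied to \<open>F\<close> and carried over to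
    \<open>f\<close> by \<open>same_derivative\<close>. All quantifiers now range over countable
    sets.\<close>
  have "D = {x. x \<in> U \<and> (\<forall>m::nat. \<exists>n::nat. \<forall>h\<in>\<rat>. \<forall>k\<in>\<rat>.
      0 < \<bar>h\<bar> \<and> \<bar>h\<bar> < 1 / Suc n \<and> 0 < \<bar>k\<bar> \<and> \<bar>k\<bar> < 1 / Suc n \<longrightarrow> \<bar>q h x - q k x\<bar> \<le> 1 / Suc m)}"
    using differentiable_iff_rational_Cauchy[OF \<open>open U\<close> contF]
    by (auto simp: D_def q_def real_differentiable_def same_derivative)
  also have "\<dots> \<in> sets borel"
    using countable_rat by measurable
  finally have [measurable]: "D \<in> sets borel" .
  have "deriv f x = lim (\<lambda>i. q (1 / Suc i) x)" if "x \<in> D" for x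
  proof -
    have "x \<in> U" "(f has_field_derivative deriv f x) (at x)"
      using that by (auto simp: D_def DERIV_deriv_iff_real_differentiable)
    then have "((\<lambda>h. q h x) \<longlongrightarrow> deriv f x) (at 0)"
      using same_derivative by (auto simp: q_def DERIV_def)
    moreover have "filterlim (\<lambda>i. 1 / real (Suc i)) (at 0) sequentially"
      by real_asymp
    ultimately have "(\<lambda>i. q (1 / Suc i) x) \<longlonglongrightarrow> deriv f x"
      by (rule filterlim_compose)
    then show ?thesis
      by (simp add: limI)
  qed
  then have "(\<lambda>x. if x \<in> U \<and> f differentiable (at x) then deriv f x else 0) =
      (\<lambda>x. if x \<in> D then lim (\<lambda>i. q (1 / Suc i) x) else 0)"
    by (auto simp: D_def)
  then show ?thesis
    by simp
qed

section \<open>Probability charts\<close>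

text \<open>The range (0,1) has no extreme values: the preimages of \<open>G x / 2\<close> and
  \<open>(G x + 1) / 2\<close> lie in \<open>I\<close> on either side of \<open>x\<close>, and the
  interval \<open>I\<close> contains everything between them.\<close>

lemma probability_chart_open:
  assumes "probability_chart I G"
  shows "open I"
proof -
  have I: "is_interval I" and mono: "strict_mono_on I G" and onto: "G ` I = {0<..<1}"
    using assms by (auto simp: probability_chart_def bij_betw_def)
  have "\<exists>e>0. ball x e \<subseteq> I" if "x \<in> I" for x
  proof -
    have "G x \<in> {0<..<1}"
      using that onto by blast
    then have "G x / 2 \<in> G ` I" "(G x + 1) / 2 \<in> G ` I"
      unfolding onto by auto
    then obtain l u where "l \<in> I" "G l = G x / 2" "u \<in> I" "G u = (G x + 1) / 2"
      by (metis imageE)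
    then have "l < x" "x < u"
      using strict_mono_on_less[OF mono] that \<open>G x \<in> {0<..<1}\<close> by fastforce+
    moreover have "y \<in> I" if "l < y" "y < u" for y
      using mem_is_interval_1_I[OF I \<open>l \<in> I\<close> \<open>u \<in> I\<close>] that by auto
    ultimately show ?thesis
      by (intro exI[of _ "min (x - l) (u - x)"]) (auto simp: dist_real_def)
  qed
  then show ?thesis
    by (meson open_contains_ball)
qed

text \<open>A continuous injection of an open subset of the line into the line has a continuous
  inverse on its image; openness of \<open>I\<close> enters here.\<close>

lemma probability_chart_continuous_inverse:
  assumes "probability_chart I G"
  shows "continuous_on {0<..<1} (inv_into I G)"
proof -
  have "continuous_on (G ` I) (inv_into I G)"
    using assms probability_chart_open[OF assms]
    by (intro continuous_on_inverse_open) (auto simp: probability_chart_def bij_betw_def)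
  then show ?thesis
    using assms by (simp add: probability_chart_def bij_betw_def)
qed

text \<open>Off \<open>(0,1)\<close> the value of \<^term>\<open>inv_into I G\<close> is the fixed junk point
  \<^term>\<open>SOME x::real. False\<close>, so \<^term>\<open>slope\<close> is constant there.\<close>

definition slope :: "real set \<Rightarrow> (real \<Rightarrow> real) \<Rightarrow> real \<Rightarrow> real" where
  "slope I G y = (let b = inv_into I G y in if G differentiable (at b) then deriv G b else 0)"

text \<open>On (0,1) this is the measurable derivative composed with the continuous inverse chart;
  elsewhere it is constant. Values outside (0,1) must be covered because the sample mean can be 0,
  for instance at \<open>n = 0\<close>.\<close>

lemma borel_measurable_slope:
  assumes "probability_chart I G"
  shows "slope I G \<in> borel_measurable borel"
proof -
  let ?g = "\<lambda>x. if x \<in> I \<and> G differentiable (at x) then deriv G x else 0"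
  let ?c = "SOME x::real. False"
  let ?\<phi> = "\<lambda>y. if y \<in> {0<..<1} then inv_into I G y else ?c"
  have onto: "G ` I = {0<..<1}" and contG: "continuous_on I G"
    using assms by (auto simp: probability_chart_def bij_betw_def)
  have [measurable]: "?g \<in> borel_measurable borel"
    by (rule borel_measurable_deriv_on_open[OF probability_chart_open[OF assms] contG])
  have [measurable]: "?\<phi> \<in> borel_measurable borel"
    by (intro borel_measurable_continuous_on_if probability_chart_continuous_inverse[OF assms])
      auto
  have "inv_into I G y \<in> I" if "y \<in> {0<..<1}" for y
    using that inv_into_into[of y G I] onto by simp
  moreover have "inv_into I G y = ?c" if "y \<notin> {0<..<1}" for y
  proof -
    \<comment> \<open>The predicate inside the choice operator is literally the constant false one,
      so the chosen point is the same for every such \<open>y\<close>.\<close>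
    have "(\<lambda>x. x \<in> I \<and> G x = y) = (\<lambda>_. False)"
      using that onto by blast
    then show ?thesis
      by (simp add: inv_into_def)
  qed
  ultimately have "slope I G y = (if y \<in> {0<..<1} then ?g (?\<phi> y)
      else if G differentiable (at ?c) then deriv G ?c else 0)" for y
    by (simp add: slope_def Let_def)
  then have "slope I G = (\<lambda>y. if y \<in> {0<..<1} then ?g (?\<phi> y)
      else if G differentiable (at ?c) then deriv G ?c else 0)"
    by (rule ext)
  also have "\<dots> \<in> borel_measurable borel"
  proof (rule measurable_If_set)
    show "(\<lambda>y. ?g (?\<phi> y)) \<in> borel_measurable borel"
      by (rule measurable_compose[of ?\<phi> borel borel ?g]) fact+
  qed auto
  finally show ?thesis .
qed

text \<open>Near \<open>p\<close> the inverse chart stays in \<open>S\<close>, where the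
  differentiability test always succeeds and \<open>deriv G\<close> is continuous; there
  \<open>slope\<close> is a composition of continuous maps.\<close>

lemma isCont_slope:
  assumes chart: "probability_chart I G" and p: "p \<in> {0<..<1}"
    and S: "open S" "inv_into I G p \<in> S" "G C1_differentiable_on S"
  shows "isCont (slope I G) p" and "slope I G p = deriv G (inv_into I G p)"
proof -
  let ?\<phi> = "inv_into I G"
  have diff: "G differentiable (at x)" if "x \<in> S" for x
    using S(3) that by (simp add: C1_differentiable_on_eq)
  \<comment> \<open>C1 differentiability is phrased with the vector derivative, which has to be
    identified with \<open>deriv G\<close>.\<close>
  have "vector_derivative G (at x) = deriv G x" if "x \<in> S" for x
    using diff[OF that]
    by (intro vector_derivative_at)
      (simp add: DERIV_deriv_iff_real_differentiable flip: has_real_derivative_iff_has_vector_derivative)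
  then have "continuous_on S (deriv G)"
    using S(3) by (simp add: C1_differentiable_on_eq cong: continuous_on_cong)
  then have "isCont (deriv G) (?\<phi> p)"
    using S by (simp add: continuous_on_eq_continuous_at)
  moreover have \<phi>: "isCont ?\<phi> p"
    using probability_chart_continuous_inverse[OF chart] p
    by (simp add: continuous_on_eq_continuous_at)
  ultimately have "isCont (\<lambda>y. deriv G (?\<phi> y)) p"
    using isCont_o2 by blast
  moreover have "\<forall>\<^sub>F y in nhds p. ?\<phi> y \<in> S"
    using topological_tendstoD[OF _ S(1,2)] \<phi>
    by (simp add: isCont_def tendsto_at_iff_tendsto_nhds)
  then have "\<forall>\<^sub>F y in nhds p. slope I G y = deriv G (?\<phi> y)"
    by (rule eventually_mono) (simp add: slope_def diff)
  ultimately show "isCont (slope I G) p"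
    by (simp add: isCont_cong)
  show "slope I G p = deriv G (?\<phi> p)"
    by (simp add: slope_def diff S)
qed

lemma borel_measurable_chart_value:
  assumes "probability_chart I G"
  shows "chart_value I G \<in> borel_measurable borel"
proof -
  have "continuous_on I G"
    using assms by (simp add: probability_chart_def)
  then show ?thesis
    using probability_chart_open[OF assms] unfolding chart_value_def
    by (intro borel_measurable_continuous_on_if) auto
qed

lemma chart_value_bounds:
  assumes "probability_chart I G"
  shows "chart_value I G x \<in> {0..1}" and "x \<in> I \<Longrightarrow> chart_value I G x \<in> {0<..<1}"
proof -
  have "G ` I = {0<..<1}"
    using assms by (simp add: probability_chart_def bij_betw_def)
  then show "x \<in> I \<Longrightarrow> chart_value I G x \<in> {0<..<1}"
    by (auto simp: chart_value_def)
  then show "chart_value I G x \<in> {0..1}"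
    by (force simp: chart_value_def)
qed

text \<open>A variable lying strictly between 0 and 1 almost surely has its mean strictly between
  them as well. This places the coordinate mean in the range of \<open>G\<close>, where the inverse
  chart is continuous.\<close>

lemma (in prob_space) coord_mean_bounds:
  assumes chart: "probability_chart I G" and [measurable]: "random_variable borel X"
    and "AE \<omega> in M. X \<omega> \<in> I"
  shows "coord_mean M I G X \<in> {0<..<1}"
proof -
  note [measurable] = borel_measurable_chart_value[OF chart]
  let ?U = "\<lambda>\<omega>. chart_value I G (X \<omega>)"
  have AE: "AE \<omega> in M. 0 < ?U \<omega> \<and> ?U \<omega> < 1"
    using assms(3) by eventually_elim (use chart_value_bounds(2)[OF chart] in auto)
  have "integrable M ?U"
    using chart_value_bounds(1)[OF chart] by (intro integrable_const_bound[of _ 1]) auto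
  then have "expectation ?U > 0" "expectation ?U < 1"
    using AE expectation_less[of ?U 1] expectation_greater[of ?U 0] by (auto elim: eventually_mono)
  then show ?thesis
    by (simp add: coord_mean_def)
qed

section \<open>The estimators\<close>

text \<open>Expanding the square expresses the sample variance through the two empirical moments.
  Division by zero yields 0 on both sides, so \<open>n = 0\<close> and \<open>n = 1\<close> need no
  exclusion.\<close>

lemma var_est_eq:
  "var_est I G X n \<omega> = real n / (real n - 1) *
     ((\<Sum>i=1..n. (chart_value I G (X i \<omega>))\<^sup>2) / real n - (sample_mean I G X n \<omega>)\<^sup>2)"
proof (cases "n = 0")
  case False
  let ?U = "\<lambda>i. chart_value I G (X i \<omega>)" and ?m = "sample_mean I G X n \<omega>"
  have "(\<Sum>i=1..n. ?U i) = real n * ?m"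
    using False by (simp add: sample_mean_def)
  moreover have "(\<Sum>i=1..n. (?U i - ?m)\<^sup>2) =
      (\<Sum>i=1..n. (?U i)\<^sup>2) - 2 * ?m * (\<Sum>i=1..n. ?U i) + real n * ?m\<^sup>2"
    by (simp add: power2_diff sum.distrib sum_subtractf sum_distrib_left algebra_simps)
  ultimately have "(\<Sum>i=1..n. (?U i - ?m)\<^sup>2) = (\<Sum>i=1..n. (?U i)\<^sup>2) - real n * ?m\<^sup>2"
    by (simp add: power2_eq_square)
  also have "\<dots> = real n * ((\<Sum>i=1..n. (?U i)\<^sup>2) / real n - ?m\<^sup>2)"
    using False by (simp add: right_diff_distrib)
  finally show ?thesis
    by (simp add: var_est_def)
qed (simp add: var_est_def)

text \<open>The convention for a missing or vanishing derivative agrees with division by zero,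
  because \<open>slope\<close> is then 0.\<close>

lemma tau_sq_est_eq:
  "tau_sq_est I G X n \<omega> = var_est I G X n \<omega> / (slope I G (sample_mean I G X n \<omega>))\<^sup>2"
  by (simp add: tau_sq_est_def slope_def barycenter_est_def Let_def)

text \<open>For \<open>n > 0\<close> the scale factors cancel and the deviation events coincide;
  only \<open>n = 0\<close> differs.\<close>

lemma converges_in_probability_rescale:
  assumes "converges_in_probability M T (\<lambda>_. t)"
  shows "converges_in_probability M (\<lambda>n \<omega>. real n * (T n \<omega> / real n - t / real n)) (\<lambda>_. 0)"
proof -
  have [measurable]: "T n \<in> borel_measurable M" for n
    using assms by (simp add: converges_in_probability_def)
  have "(\<lambda>n. measure M {\<omega> \<in> space M. \<bar>real n * (T n \<omega> / real n - t / real n) - 0\<bar> > \<epsilon>}) \<longlonglongrightarrow> 0"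
    if "\<epsilon> > 0" for \<epsilon>
  proof (rule Lim_transform_eventually)
    show "(\<lambda>n. measure M {\<omega> \<in> space M. \<bar>T n \<omega> - t\<bar> > \<epsilon>}) \<longlonglongrightarrow> 0"
      using assms that by (simp add: converges_in_probability_def)
    show "\<forall>\<^sub>F n in sequentially. measure M {\<omega> \<in> space M. \<bar>T n \<omega> - t\<bar> > \<epsilon>} =
        measure M {\<omega> \<in> space M. \<bar>real n * (T n \<omega> / real n - t / real n) - 0\<bar> > \<epsilon>}"
      using eventually_gt_at_top[of 0] by (rule eventually_mono) (simp add: right_diff_distrib)
  qed
  then show ?thesis
    by (auto simp: converges_in_probability_def)
qed

theorem proposition3p1:
  fixes M :: "'a measure" and P :: "real measure"
    and X :: "nat \<Rightarrow> 'a \<Rightarrow> real"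
    and I :: "real set" and G :: "real \<Rightarrow> real"
  assumes "prob_space M"
    and "probability_chart I G"
    and "prob_space.indep_vars M (\<lambda>_. borel) X UNIV"
    and "\<And>i. distr M borel (X i) = P"
    and "measure P I = 1"
    and "\<exists>S. open S \<and> barycenter M I G (X 0) \<in> S \<and> S \<subseteq> I \<and> G C1_differentiable_on S"
    and "deriv G (barycenter M I G (X 0)) > 0"
  shows "converges_in_probability M (tau_sq_est I G X) (\<lambda>_. tau_sq M I G (X 0))
    \<and> converges_in_probability M
        (\<lambda>n \<omega>. real n * (tau_sq_est I G X n \<omega> / real n - tau_sq M I G (X 0) / real n)) (\<lambda>_. 0)"
proof -
  interpret prob_space M by fact
  note chart = \<open>probability_chart I G\<close>
  have [measurable]: "random_variable borel (X i)" for i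
    using assms(3) unfolding indep_vars_def by blast
  note [measurable] = borel_measurable_chart_value[OF chart] borel_measurable_slope[OF chart]
  have [measurable]: "I \<in> sets borel"
    using probability_chart_open[OF chart] by simp
  let ?U = "\<lambda>i \<omega>. chart_value I G (X i \<omega>)"
  let ?A = "\<lambda>n \<omega>. (\<Sum>i=1..n. ?U i \<omega>) / real n" and ?B = "\<lambda>n \<omega>. (\<Sum>i=1..n. (?U i \<omega>)\<^sup>2) / real n"
  \<comment> \<open>The estimator as a function of \<open>n\<close>, the first empirical moment
    \<open>a\<close> and the second empirical moment \<open>b\<close>.\<close>
  let ?F = "\<lambda>n a b. real n / (real n - 1) * (b - a\<^sup>2) / (slope I G a)\<^sup>2"
  define p where "p = coord_mean M I G (X 0)"
  define s where "s = expectation (\<lambda>\<omega>. (?U 0 \<omega>)\<^sup>2)"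
  define b where "b = barycenter M I G (X 0)"
  have U: "0 \<le> ?U i \<omega>" "?U i \<omega> \<le> 1" for i \<omega>
    using chart_value_bounds(1)[OF chart] by auto
  have U2: "0 \<le> (?U i \<omega>)\<^sup>2" "(?U i \<omega>)\<^sup>2 \<le> 1" for i \<omega>
    using U by (auto simp: abs_square_le_1)
  have integrable: "integrable M (?U 0)" "integrable M (\<lambda>\<omega>. (?U 0 \<omega>)\<^sup>2)"
    using U U2 by (auto intro!: integrable_const_bound[of _ 1])
  have "measure M (X 0 -` I \<inter> space M) = 1"
    using assms(4)[of 0] assms(5) by (auto simp: measure_distr)
  then have "AE \<omega> in M. X 0 \<omega> \<in> I"
    by (subst (asm) prob_eq_1) auto
  then have p: "p \<in> {0<..<1}"
    unfolding p_def by (intro coord_mean_bounds[OF chart]) auto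
  \<comment> \<open>The law of \<open>f (X i)\<close> is the image of \<open>P\<close> under
    \<open>f\<close>, hence does not depend on \<open>i\<close>. It is used for
    \<open>chart_value I G\<close> and for its square.\<close>
  have image_distr: "distr M borel (\<lambda>\<omega>. f (X i \<omega>)) = distr M borel (\<lambda>\<omega>. f (X 0 \<omega>))"
    if "f \<in> borel_measurable borel" for f :: "real \<Rightarrow> real" and i
    using distr_distr[of f borel borel "X i" M] distr_distr[of f borel borel "X 0" M] that
    by (simp add: assms(4) o_def)
  have A: "converges_in_probability M ?A (\<lambda>_. p)"
    unfolding p_def coord_mean_def
    by (rule weak_law_bounded_iid[of _ 0 1])
      (use U in \<open>auto intro!: image_distr indep_vars_compose2[OF assms(3)]\<close>)
  have B: "converges_in_probability M ?B (\<lambda>_. s)"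
    unfolding s_def
    by (rule weak_law_bounded_iid[of _ 0 1])
      (use U2 in \<open>auto intro!: image_distr[of "\<lambda>x. (chart_value I G x)\<^sup>2"] 
        indep_vars_compose2[OF assms(3)]\<close>)
  have cont: "isCont (slope I G) p" and slope_p: "slope I G p = deriv G b"
    using assms(6) isCont_slope[OF chart p] by (auto simp: b_def barycenter_def p_def)
  \<comment> \<open>The factor 1 is the limit of n/(n-1); keeping it gives the target the same shape
    as \<open>?F\<close>.\<close>
  have tau: "tau_sq M I G (X 0) = 1 * (s - p\<^sup>2) / (slope I G p)\<^sup>2"
    using variance_eq[OF integrable] unfolding slope_p
    by (simp add: tau_sq_def coord_var_def b_def s_def p_def coord_mean_def)
  have "((\<lambda>(n, a, b). ?F n a b) \<longlongrightarrow> tau_sq M I G (X 0)) (sequentially \<times>\<^sub>F nhds p \<times>\<^sub>F nhds s)"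
  proof -
    let ?E = "sequentially \<times>\<^sub>F nhds p \<times>\<^sub>F nhds s"
    have n: "filterlim fst sequentially ?E"
      by (rule filterlim_fst)
    have a: "((\<lambda>z. fst (snd z)) \<longlongrightarrow> p) ?E"
      by (rule filterlim_compose[OF filterlim_fst filterlim_snd])
    have b: "((\<lambda>z. snd (snd z)) \<longlongrightarrow> s) ?E"
      by (rule filterlim_compose[OF filterlim_snd filterlim_snd])
    have "(\<lambda>n. real n / (real n - 1)) \<longlonglongrightarrow> 1"
      by real_asymp
    \<comment> \<open>The quotient rule requires a nonzero limit of the denominator, which is the
      positivity of the derivative at the barycenter.\<close>
    from filterlim_compose[OF this n] show ?thesis
      unfolding tau case_prod_unfold
      by (intro tendsto_intros a b isCont_tendsto_compose[OF cont])
        (use assms(7) slope_p in \<open>auto simp: b_def\<close>)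
  qed
  then have "converges_in_probability M (\<lambda>n \<omega>. ?F n (?A n \<omega>) (?B n \<omega>)) (\<lambda>_. tau_sq M I G (X 0))"
    by (intro converges_in_probability_compose2[OF A B]) measurable
  \<comment> \<open>The identity holds at every sample point and for every \<open>n\<close>, so
    measurability of the estimator comes along with its convergence.\<close>
  moreover have "(\<lambda>n \<omega>. ?F n (?A n \<omega>) (?B n \<omega>)) = tau_sq_est I G X"
    by (intro ext) (simp add: tau_sq_est_eq var_est_eq sample_mean_def)
  ultimately have "converges_in_probability M (tau_sq_est I G X) (\<lambda>_. tau_sq M I G (X 0))"
    by simp
  then show ?thesis
    using converges_in_probability_rescale by blast
qed

end
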